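(* For every constant $\epsilon\in(0,1)$ there exist a constant $K=K(\epsilon)$ and a randomized mechanism that, for every $n\ge 1$ and every ordinal matching problem instance with $n$ agents and $n$ items, outputs a matching $M$ of size $\lceil(1-\epsilon)n\rceil$ with expected distortion $O(1)$: for every metric $d$ consistent with the instance, $\mathbb{E}[\mathrm{cost}_d(M)]\le K\cdot\mathrm{cost}_d(M_{\mathrm{OPT}})$, where $M_{\mathrm{OPT}}$ is a minimum-cost perfect matching with respect to $d$.
   Context: Agents $A=\{a_1,\dots,a_n\}$ and items $B=\{b_1,\dots,b_n\}$. A metric is a function $d:(A\cup B)\times(A\cup B)\to\mathbb{R}_{\ge 0}$ with $d(x,x)=0$, $d(x,y)=d(y,x)$ and $d(x,y)\le d(x,z)+d(z,y)$ (distinct points are allowed to be at distance $0$). An ordinal matching problem instance consists of $n$ preference lists, one per agent; each list is a permutation of $B$. A metric $d$ is consistent with the instance if, for every agent $a_i$, whenever $b_j$ appears before $b_k$ in the list of $a_i$ we have $d(a_i,b_j)\le d(a_i,b_k)$. A (not necessarily perfect) matching $M$ is a set of agent-item pairs in which each agent and each item appears at most once; $\mathrm{cost}_d(M)=\sum_{(a,b)\in M}d(a,b)$. A perfect matching has $n$ pairs. A randomized mechanism maps each instance (it sees only the preference lists, not $d$) to a probability distribution over matchings. The cost of the output matching, even if not perfect, is always compared with the cost of the optimal perfect matching. *)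

theory Defs
  imports "HOL-Probability.Probability_Mass_Function"
begin

text \<open>Agents and items are both indexed by \<open>{..<n}\<close>; the constructors keep \<open>A\<close> and \<open>B\<close> disjoint.\<close>

datatype point = Agent nat | Item nat

definition points :: "nat \<Rightarrow> point set" where
  "points n = Agent ` {..<n} \<union> Item ` {..<n}"

text \<open>The values of \<open>d\<close> outside \<open>points n\<close> are unconstrained and never used. Distinct points may be
  at distance \<open>0\<close>, so the library's metric spaces do not apply.\<close>

definition is_metric :: "nat \<Rightarrow> (point \<Rightarrow> point \<Rightarrow> real) \<Rightarrow> bool" where
  "is_metric n d \<longleftrightarrow>
     (\<forall>x\<in>points n. \<forall>y\<in>points n. 0 \<le> d x y) \<and>
     (\<forall>x\<in>points n. d x x = 0) \<and>
     (\<forall>x\<in>points n. \<forall>y\<in>points n. d x y = d y x) \<and>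
     (\<forall>x\<in>points n. \<forall>y\<in>points n. \<forall>z\<in>points n. d x y \<le> d x z + d z y)"

text \<open>The \<open>i\<close>-th entry of an instance is the preference list of agent \<open>i\<close>, best item first.\<close>

definition ordinal_instance :: "nat \<Rightarrow> nat list list \<Rightarrow> bool" where
  "ordinal_instance n P \<longleftrightarrow> length P = n \<and> (\<forall>L\<in>set P. distinct L \<and> set L = {..<n})"

definition consistent :: "nat \<Rightarrow> (point \<Rightarrow> point \<Rightarrow> real) \<Rightarrow> nat list list \<Rightarrow> bool" where
  "consistent n d P \<longleftrightarrow>
     (\<forall>i<n. \<forall>p q. p < q \<and> q < n \<longrightarrow>
        d (Agent i) (Item (P ! i ! p)) \<le> d (Agent i) (Item (P ! i ! q)))"

definition matching :: "nat \<Rightarrow> (nat \<times> nat) set \<Rightarrow> bool" where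
  "matching n M \<longleftrightarrow> M \<subseteq> {..<n} \<times> {..<n} \<and> inj_on fst M \<and> inj_on snd M"

definition perfect_matching :: "nat \<Rightarrow> (nat \<times> nat) set \<Rightarrow> bool" where
  "perfect_matching n M \<longleftrightarrow> matching n M \<and> card M = n"

definition cost :: "(point \<Rightarrow> point \<Rightarrow> real) \<Rightarrow> (nat \<times> nat) set \<Rightarrow> real" where
  "cost d M = (\<Sum>(a, b)\<in>M. d (Agent a) (Item b))"

definition optimal_matching ::
    "nat \<Rightarrow> (point \<Rightarrow> point \<Rightarrow> real) \<Rightarrow> (nat \<times> nat) set \<Rightarrow> bool" where
  "optimal_matching n d M \<longleftrightarrow> is_arg_min (cost d) (perfect_matching n) M"

lemma optimal_matching_exists: "\<exists>M. optimal_matching n d M"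
proof -
  have "{M. perfect_matching n M} \<subseteq> Pow ({..<n} \<times> {..<n})"
    by (auto simp: perfect_matching_def matching_def)
  then have fin: "finite {M. perfect_matching n M}"
    by (rule finite_subset) simp
  have "card ((\<lambda>i. (i, i)) ` {..<n}) = n"
    by (simp add: card_image inj_on_def)
  then have "perfect_matching n ((\<lambda>i. (i, i)) ` {..<n})"
    by (auto simp: perfect_matching_def matching_def inj_on_def)
  then have ne: "{M. perfect_matching n M} \<noteq> {}"
    by blast
  from ex_is_arg_min_if_finite[OF fin ne] show ?thesis
    by (simp add: optimal_matching_def)
qed

text \<open>The number of agents is the length of the instance, so a mechanism gets the preference
  lists as its only argument.\<close>

definition randomized_mechanism :: "(nat list list \<Rightarrow> (nat \<times> nat) set pmf) \<Rightarrow> bool" where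
  "randomized_mechanism F \<longleftrightarrow>
     (\<forall>n P. ordinal_instance n P \<longrightarrow> (\<forall>M\<in>set_pmf (F P). matching n M))"

end

theory Submission
  imports Defs "HOL-Combinatorics.Transposition"
begin

text \<open>The mechanism is random serial dictatorship, stopped after \<open>m = \<lceil>(1 - \<epsilon>) n\<rceil>\<close> picks. After \<open>t\<close> picks with total
  cost \<open>C\<close>, the alternating paths of the optimum and the current matching pair the remaining agents
  with the remaining items at total cost at most \<open>OPT + C\<close>. Every remaining agent would pick an item
  no farther than its partner in this pairing, so the next pick, made by a uniformly random remaining
  agent, costs at most \<open>(OPT + C) / (n - t)\<close> in expectation. Hence \<open>(n - t + 1) (OPT + E[C])\<close> does
  not increase with \<open>t\<close>, and at \<open>t = m\<close> the factor \<open>n - m + 1\<close> exceeds \<open>\<epsilon> n\<close>.\<close>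

section \<open>The mechanism and its greedy choice\<close>

definition favourite :: "nat list \<Rightarrow> nat set \<Rightarrow> nat" where
  "favourite L T = hd (filter (\<lambda>b. b \<notin> T) L)"

definition serial_pick :: "nat list list \<Rightarrow> (nat \<times> nat) set \<Rightarrow> nat \<Rightarrow> (nat \<times> nat) set" where
  "serial_pick P M a = insert (a, favourite (P ! a) (snd ` M)) M"

text \<open>The random order is drawn one agent at a time, so that an expectation can be conditioned
  on the current matching. The set sampled from is nonempty only while \<open>t < length P\<close>;
  later results therefore assume \<open>t \<le> n\<close>.\<close>

fun random_serial_dictatorship :: "nat list list \<Rightarrow> nat \<Rightarrow> (nat \<times> nat) set pmf" where
  "random_serial_dictatorship P 0 = return_pmf {}"
| "random_serial_dictatorship P (Suc t) =
     random_serial_dictatorship P t \<bind>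
       (\<lambda>M. map_pmf (serial_pick P M) (pmf_of_set ({..<length P} - fst ` M)))"

text \<open>\<open>consistent\<close> compares positions in a list, whereas \<open>favourite\<close>
  is defined by filtering; this translates between the two.\<close>

lemma filter_hd_position:
  assumes "x \<in> set L" and "Q x"
  obtains p where "p < length L" and "L ! p = hd (filter Q L)" and "Q (L ! p)"
    and "\<And>q. \<lbrakk>q < length L; Q (L ! q)\<rbrakk> \<Longrightarrow> p \<le> q"
proof -
  have "\<exists>p<length L. L ! p = hd (filter Q L) \<and> Q (L ! p) \<and>
      (\<forall>q<length L. Q (L ! q) \<longrightarrow> p \<le> q)"
    using assms
  proof (induction L)
    case (Cons y L)
    show ?case
    proof (cases "Q y")
      case True
      then show ?thesis by (intro exI[of _ 0]) auto
    next
      case False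
      with Cons obtain p where p: "p < length L" "L ! p = hd (filter Q L)" "Q (L ! p)"
        "\<forall>q<length L. Q (L ! q) \<longrightarrow> p \<le> q" by auto
      have "Suc p \<le> q" if "q < length (y # L)" "Q ((y # L) ! q)" for q
        using that False p(4) by (cases q) auto
      with p False show ?thesis by (intro exI[of _ "Suc p"]) auto
    qed
  qed simp
  with that show thesis by blast
qed

text \<open>\<open>hd\<close> is unspecified on an empty list; the free item \<open>x\<close>
  excludes that case.\<close>

lemma favourite_free:
  assumes "x \<in> set L - T"
  shows "favourite L T \<in> set L - T"
proof -
  from assms have "filter (\<lambda>b. b \<notin> T) L \<noteq> []"
    by (auto simp: filter_empty_conv)
  from hd_in_set[OF this] show ?thesis by (simp add: favourite_def)
qed

lemma favourite_closest:
  assumes P: "ordinal_instance n P" and con: "consistent n d P"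
    and a: "a < n" and b: "b \<in> {..<n} - T"
  shows "d (Agent a) (Item (favourite (P ! a) T)) \<le> d (Agent a) (Item b)"
proof -
  from P a have dist: "distinct (P ! a)" and set: "set (P ! a) = {..<n}"
    by (simp_all add: ordinal_instance_def)
  from dist set have len: "length (P ! a) = n"
    by (metis distinct_card card_lessThan)
  from b set have "b \<in> set (P ! a)" "b \<notin> T" by auto
  then obtain p where p: "p < length (P ! a)" "P ! a ! p = hd (filter (\<lambda>b. b \<notin> T) (P ! a))"
    and least: "\<And>q. \<lbrakk>q < length (P ! a); P ! a ! q \<notin> T\<rbrakk> \<Longrightarrow> p \<le> q"
    by (rule filter_hd_position[where Q = "\<lambda>b. b \<notin> T"]) auto
  from \<open>b \<in> set (P ! a)\<close> obtain q where q: "q < length (P ! a)" "P ! a ! q = b"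
    by (auto simp: in_set_conv_nth)
  with least \<open>b \<notin> T\<close> have "p \<le> q" by auto
  \<comment> \<open>\<open>consistent\<close> covers only strictly increasing positions, hence the
    separate case \<open>p = q\<close>.\<close>
  then have "d (Agent a) (Item (P ! a ! p)) \<le> d (Agent a) (Item (P ! a ! q))"
    using con a q len by (cases "p = q") (auto simp: consistent_def)
  with p q show ?thesis by (simp add: favourite_def)
qed

section \<open>Matchings and the outcomes of the mechanism\<close>

lemma matching_finite: "matching n M \<Longrightarrow> finite M"
  unfolding matching_def by (auto intro: finite_subset)

lemma card_free_agents:
  assumes "matching n M"
  shows "card ({..<n} - fst ` M) = n - card M"
proof -
  from assms have "fst ` M \<subseteq> {..<n}" "card (fst ` M) = card M"
    by (auto simp: matching_def card_image)
  then show ?thesis using matching_finite[OF assms] by (simp add: card_Diff_subset)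
qed

lemma card_free_items:
  assumes "matching n M"
  shows "card ({..<n} - snd ` M) = n - card M"
proof -
  from assms have "snd ` M \<subseteq> {..<n}" "card (snd ` M) = card M"
    by (auto simp: matching_def card_image)
  then show ?thesis using matching_finite[OF assms] by (simp add: card_Diff_subset)
qed

lemma cost_insert:
  assumes "finite M" and "a \<notin> fst ` M"
  shows "cost d (insert (a, b) M) = d (Agent a) (Item b) + cost d M"
  using assms by (subst cost_def, subst sum.insert) (auto simp: cost_def image_iff)

lemma serial_pick_matching:
  assumes P: "ordinal_instance n P" and M: "matching n M" "card M < n"
    and a: "a \<in> {..<n} - fst ` M"
  shows "matching n (serial_pick P M a)" and "card (serial_pick P M a) = Suc (card M)"
proof -
  from M have "card ({..<n} - snd ` M) \<noteq> 0" by (simp add: card_free_items)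
  then obtain x where "x \<in> {..<n} - snd ` M" by (metis card.empty ex_in_conv)
  moreover from P a have "set (P ! a) = {..<n}" by (simp add: ordinal_instance_def)
  ultimately have "favourite (P ! a) (snd ` M) \<in> {..<n} - snd ` M"
    using favourite_free by metis
  with M a show "matching n (serial_pick P M a)"
    unfolding matching_def serial_pick_def inj_on_insert by auto
  from a have "(a, b) \<notin> M" for b by force
  with matching_finite[OF M(1)] show "card (serial_pick P M a) = Suc (card M)"
    by (simp add: serial_pick_def)
qed

lemma free_agents_nonempty:
  assumes "matching n M" and "card M < n"
  shows "{..<n} - fst ` M \<noteq> {}"
  using card_free_agents[OF assms(1)] assms(2) by fastforce

text \<open>Before each of the first \<open>n\<close> picks some agent is free, so
  \<open>pmf_of_set\<close> really is supported on the free agents, and every pick adds a new agent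
  with a new item.\<close>

lemma random_serial_dictatorship_matching:
  assumes P: "ordinal_instance n P" and "t \<le> n" and "M \<in> set_pmf (random_serial_dictatorship P t)"
  shows "matching n M \<and> card M = t"
  using assms(2,3)
proof (induction t arbitrary: M)
  case 0
  then show ?case by (simp add: matching_def)
next
  case (Suc t)
  from P have len: "length P = n" by (simp add: ordinal_instance_def)
  from Suc.prems(2) obtain N
    where N: "N \<in> set_pmf (random_serial_dictatorship P t)"
      and M: "M \<in> serial_pick P N ` set_pmf (pmf_of_set ({..<n} - fst ` N))"
    by (auto simp: len)
  from Suc.IH[OF _ N] Suc.prems(1) have "matching n N" "card N < n" "card N = t" by auto
  with M show ?case
    using serial_pick_matching[OF P] free_agents_nonempty by auto
qed

section \<open>Pairing the free agents with the free items\<close>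

lemma metric_quadrilateral:
  assumes met: "is_metric n d" and "a < n" "a' < n" "b < n" "b' < n"
  shows "d (Agent a') (Item b') \<le>
    d (Agent a') (Item b) + d (Agent a) (Item b) + d (Agent a) (Item b')"
proof -
  have pts: "Agent a \<in> points n" "Agent a' \<in> points n" "Item b \<in> points n" "Item b' \<in> points n"
    using assms by (auto simp: points_def)
  with met have "d (Agent a') (Item b') \<le> d (Agent a') (Item b) + d (Item b) (Item b')"
    "d (Item b) (Item b') \<le> d (Item b) (Agent a) + d (Agent a) (Item b')"
    "d (Item b) (Agent a) = d (Agent a) (Item b)"
    unfolding is_metric_def by blast+
  then show ?thesis by linarith
qed

text \<open>A function on agents is easier to alter by swaps than a set of pairs. It is obtained by
  going back along \<open>fst\<close> to the pair of an agent and reading off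
  \<open>snd\<close>.\<close>

lemma perfect_matching_bij:
  assumes "perfect_matching n M"
  obtains f where "bij_betw f {..<n} {..<n}"
    and "(\<Sum>a<n. d (Agent a) (Item (f a))) = cost d M"
proof -
  from assms have M: "matching n M" "card M = n" by (auto simp: perfect_matching_def)
  then have "card (fst ` M) = card {..<n}" "card (snd ` M) = card {..<n}"
    and "fst ` M \<subseteq> {..<n}" "snd ` M \<subseteq> {..<n}"
    by (auto simp: matching_def card_image)
  then have "fst ` M = {..<n}" "snd ` M = {..<n}"
    by (simp_all add: card_subset_eq)
  with M have bij: "bij_betw fst M {..<n}" "bij_betw snd M {..<n}"
    by (auto simp: bij_betw_def matching_def)
  have inv: "inv_into M fst (fst e) = e" if "e \<in> M" for e
    using that bij(1) by (simp add: bij_betw_def)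
  have "(\<Sum>a<n. d (Agent a) (Item (snd (inv_into M fst a)))) =
      (\<Sum>e\<in>M. d (Agent (fst e)) (Item (snd e)))"
    by (subst sum.reindex_bij_betw[OF bij(1), symmetric]) (simp add: inv)
  then have "(\<Sum>a<n. d (Agent a) (Item ((snd \<circ> inv_into M fst) a))) = cost d M"
    by (simp add: cost_def case_prod_unfold)
  with bij_betw_trans[OF bij_betw_inv_into[OF bij(1)] bij(2)] show thesis by (rule that)
qed

text \<open>Induction on \<open>M\<close> replaces explicit alternating paths. When \<open>a\<close>
  takes \<open>b\<close>, the former partner \<open>a'\<close> of \<open>b\<close> inherits the item
  that \<open>a\<close> was paired with, which raises the total by at most the distance of
  \<open>a\<close> and \<open>b\<close>. The order of insertion is irrelevant.\<close>

lemma free_pairing: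
  assumes met: "is_metric n d" and opt: "perfect_matching n Opt" and M: "matching n M"
  shows "\<exists>f. bij_betw f ({..<n} - fst ` M) ({..<n} - snd ` M) \<and>
    (\<Sum>a\<in>{..<n} - fst ` M. d (Agent a) (Item (f a))) \<le> cost d Opt + cost d M"
  using matching_finite[OF M] M
proof (induction M rule: finite_induct)
  case empty
  obtain f where "bij_betw f {..<n} {..<n}"
    "(\<Sum>a<n. d (Agent a) (Item (f a))) = cost d Opt"
    using perfect_matching_bij[OF opt] .
  then show ?case by (intro exI[of _ f]) (simp add: cost_def)
next
  case (insert e M)
  obtain a b where e: "e = (a, b)" by (cases e)
  let ?R = "{..<n} - fst ` M" and ?F = "{..<n} - snd ` M"
  let ?c = "\<lambda>f a. d (Agent a) (Item (f a))"
  from insert.prems insert.hyps(2) have M: "matching n M" and a: "a \<in> ?R" and b: "b \<in> ?F"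
    unfolding matching_def inj_on_insert e by simp_all
  with insert.IH obtain f where f: "bij_betw f ?R ?F"
    and le: "sum (?c f) ?R \<le> cost d Opt + cost d M" by auto
  from f b obtain a' where a': "a' \<in> ?R" "f a' = b" unfolding bij_betw_def by (metis imageE)
  \<comment> \<open>Swapping gives \<open>b\<close> to \<open>a\<close>, so this pair can be deleted
    and a bijection of the remaining agents and items is left.\<close>
  define g where "g = f \<circ> Transposition.transpose a a'"
  have "bij_betw (Transposition.transpose a a') ?R ?R"
    using a a'(1) by (simp add: bij_betw_def)
  then have "bij_betw g ?R ?F"
    using f unfolding g_def by (rule bij_betw_trans)
  have g: "g a = b" "g a' = f a" "\<And>x. x \<noteq> a \<Longrightarrow> x \<noteq> a' \<Longrightarrow> g x = f x"
    by (simp_all add: g_def a')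
  have "bij_betw g {a} {b}"
    using g(1) by (simp add: bij_betw_def)
  with \<open>bij_betw g ?R ?F\<close> have bij: "bij_betw g (?R - {a}) (?F - {b})"
    by (rule bij_betw_DiffI) (use a b in blast)+
  have "sum (?c g) (?R - {a}) \<le> sum (?c f) ?R + d (Agent a) (Item b)"
  \<comment> \<open>If \<open>a\<close> already holds \<open>b\<close>, nothing is swapped and the
    sum only loses a nonnegative term.\<close>
  proof (cases "a' = a")
    case True
    have "sum (?c g) (?R - {a}) = sum (?c f) (?R - {a})"
      using g True by (intro sum.cong) auto
    also have "\<dots> = sum (?c f) ?R - d (Agent a) (Item b)"
      using a a' True by (simp add: sum_diff1)
    also have "0 \<le> d (Agent a) (Item b)"
      using met a b by (auto simp: is_metric_def points_def)
    ultimately show ?thesis by linarith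
  next
    case False
    have "f a < n" using f a by (auto simp: bij_betw_def)
    \<comment> \<open>The route from \<open>a'\<close> to its new item passes through
      \<open>b\<close> and \<open>a\<close>. Its first and last legs are already paid for in the sum
      over \<open>f\<close>; only the middle leg is new.\<close>
    then have quad: "d (Agent a') (Item (f a)) \<le> ?c f a' + d (Agent a) (Item b) + ?c f a"
      using metric_quadrilateral[OF met, of a a' b "f a"] a a' b by simp
    have "sum (?c g) (?R - {a}) = ?c g a' + sum (?c g) (?R - {a} - {a'})"
      using a' False by (intro sum.remove) auto
    also have "sum (?c g) (?R - {a} - {a'}) = sum (?c f) (?R - {a} - {a'})"
      using g by (intro sum.cong) auto
    also have "sum (?c f) ?R = ?c f a + (?c f a' + sum (?c f) (?R - {a} - {a'}))"
      using a a' False by (subst sum.remove[of _ a], simp_all, subst sum.remove[of _ a'], simp_all)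
    ultimately show ?thesis using quad g(2) by simp
  qed
  with le have "sum (?c g) (?R - {a}) \<le> cost d Opt + (d (Agent a) (Item b) + cost d M)" by linarith
  moreover have "cost d (insert e M) = d (Agent a) (Item b) + cost d M"
    using insert.hyps(1) a unfolding e by (intro cost_insert) auto
  moreover have "?R - {a} = {..<n} - fst ` insert e M" "?F - {b} = {..<n} - snd ` insert e M"
    by (auto simp: e)
  ultimately show ?case using bij by auto
qed

section \<open>Expected growth of the cost\<close>

lemma expected_serial_pick:
  assumes P: "ordinal_instance n P" and met: "is_metric n d" and con: "consistent n d P"
    and opt: "perfect_matching n Opt" and M: "matching n M" "card M < n"
  shows "measure_pmf.expectation (map_pmf (serial_pick P M) (pmf_of_set ({..<n} - fst ` M))) (cost d)
    \<le> cost d M + (cost d Opt + cost d M) / real (n - card M)"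
proof -
  let ?R = "{..<n} - fst ` M"
  have ne: "?R \<noteq> {}" using free_agents_nonempty[OF M] .
  have k: "card ?R = n - card M" using card_free_agents[OF M(1)] .
  from free_pairing[OF met opt M(1)] obtain f where f: "bij_betw f ?R ({..<n} - snd ` M)"
    and le: "(\<Sum>a\<in>?R. d (Agent a) (Item (f a))) \<le> cost d Opt + cost d M" by blast
  \<comment> \<open>The partner \<open>f a\<close> is still free, so the favourite of
    \<open>a\<close> is no farther. Averaging over the free agents then charges a share
    \<open>1 / (n - card M)\<close> of the whole pairing.\<close>
  have "cost d (serial_pick P M a) \<le> d (Agent a) (Item (f a)) + cost d M" if "a \<in> ?R" for a
    using favourite_closest[OF P con, of a "f a" "snd ` M"] that f
    by (auto simp: serial_pick_def cost_insert matching_finite[OF M(1)] bij_betw_def)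
  then have "(\<Sum>a\<in>?R. cost d (serial_pick P M a)) \<le> (\<Sum>a\<in>?R. d (Agent a) (Item (f a)) + cost d M)"
    by (rule sum_mono)
  also have "\<dots> \<le> real (n - card M) * cost d M + (cost d Opt + cost d M)"
    using le k by (simp add: sum.distrib)
  finally have "(\<Sum>a\<in>?R. cost d (serial_pick P M a)) / real (n - card M) \<le>
      (real (n - card M) * cost d M + (cost d Opt + cost d M)) / real (n - card M)"
    by (rule divide_right_mono) simp
  also have "\<dots> = cost d M + (cost d Opt + cost d M) / real (n - card M)"
    using M(2) by (simp add: add_divide_distrib)
  finally show ?thesis
    using ne k by (simp add: integral_pmf_of_set)
qed

text \<open>Each pick multiplies expected cost plus optimum by at most
  \<open>1 + 1 / (n - t) = (n - t + 1) / (n - t)\<close>, and these factors telescope.\<close>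

lemma random_serial_dictatorship_potential:
  assumes P: "ordinal_instance n P" and met: "is_metric n d" and con: "consistent n d P"
    and opt: "perfect_matching n Opt" and "t \<le> n"
  shows "real (n - t + 1) *
      (measure_pmf.expectation (random_serial_dictatorship P t) (cost d) + cost d Opt)
    \<le> real (n + 1) * cost d Opt"
  using \<open>t \<le> n\<close>
proof (induction t)
  case 0
  then show ?case by (simp add: cost_def)
next
  case (Suc t)
  let ?p = "random_serial_dictatorship P t" and ?Ms = "{M. matching n M \<and> card M = t}"
  let ?E = "measure_pmf.expectation ?p (cost d)"
  let ?q = "\<lambda>M. map_pmf (serial_pick P M) (pmf_of_set ({..<n} - fst ` M))"
  from P have len: "length P = n" by (simp add: ordinal_instance_def)
  have fin: "finite ?Ms"
    by (rule finite_subset[of _ "Pow ({..<n} \<times> {..<n})"]) (auto simp: matching_def)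
  have supp: "set_pmf ?p \<subseteq> ?Ms"
    using random_serial_dictatorship_matching[OF P, of t] Suc.prems by auto
  \<comment> \<open>Finite supports turn the expectation of the bind into a finite sum, so the bound
    for one pick applies to each \<open>M\<close> separately.\<close>
  have "finite (set_pmf (?q M))" if "M \<in> ?Ms" for M
    using that Suc.prems free_agents_nonempty[of n M] by simp
  then have "measure_pmf.expectation (random_serial_dictatorship P (Suc t)) (cost d) =
      (\<Sum>M\<in>?Ms. pmf ?p M * measure_pmf.expectation (?q M) (cost d))"
    using pmf_expectation_bind[OF fin _ supp, of ?q "cost d"] by (simp add: len)
  also have "\<dots> \<le> (\<Sum>M\<in>?Ms. pmf ?p M * (cost d M + (cost d Opt + cost d M) / real (n - t)))"
    using expected_serial_pick[OF P met con opt] Suc.prems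
    by (intro sum_mono mult_left_mono) auto
  also have "\<dots> = measure_pmf.expectation ?p (\<lambda>M. cost d M + (cost d Opt + cost d M) / real (n - t))"
    using fin supp by (subst integral_measure_pmf[of ?Ms]) auto
  also have "\<dots> = ?E + (cost d Opt + ?E) / real (n - t)"
    using integrable_measure_pmf_finite[OF finite_subset[OF supp fin], of "cost d"] by simp
  finally have "real (n - t) *
        (measure_pmf.expectation (random_serial_dictatorship P (Suc t)) (cost d) + cost d Opt)
      \<le> real (n - t) * (?E + (cost d Opt + ?E) / real (n - t) + cost d Opt)"
    by (intro mult_left_mono) auto
  also have "\<dots> = real (n - t + 1) * (?E + cost d Opt)"
    using Suc.prems by (simp add: field_simps)
  also have "\<dots> \<le> real (n + 1) * cost d Opt"
    using Suc by simp
  \<comment> \<open>Since \<open>t < n\<close>, the truncated subtraction is harmless and the factor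
    becomes the one required for \<open>Suc t\<close>.\<close>
  also have "n - t = n - Suc t + 1" using Suc.prems by simp
  finally show ?case .
qed

section \<open>The distortion bound\<close>

lemma cost_nonneg:
  assumes "is_metric n d" and "matching n M"
  shows "0 \<le> cost d M"
  using assms unfolding cost_def is_metric_def matching_def points_def
  by (intro sum_nonneg) auto

theorem mainTheorem8:
  fixes \<epsilon> :: real
  assumes "0 < \<epsilon>" and "\<epsilon> < 1"
  shows "\<exists>(K::real) F. randomized_mechanism F \<and>
    (\<forall>n\<ge>1. \<forall>P. ordinal_instance n P \<longrightarrow>
       (\<forall>M\<in>set_pmf (F P). int (card M) = \<lceil>(1 - \<epsilon>) * real n\<rceil>) \<and>
       (\<forall>d M\<^sub>O\<^sub>P\<^sub>T. is_metric n d \<and> consistent n d P \<and> optimal_matching n d M\<^sub>O\<^sub>P\<^sub>T \<longrightarrow>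
          measure_pmf.expectation (F P) (cost d) \<le> K * cost d M\<^sub>O\<^sub>P\<^sub>T))"
proof -
  define m where "m n = nat \<lceil>(1 - \<epsilon>) * real n\<rceil>" for n
  define F where "F P = random_serial_dictatorship P (m (length P))" for P
  have m: "int (m n) = \<lceil>(1 - \<epsilon>) * real n\<rceil>" for n
  proof -
    have "0 \<le> (1 - \<epsilon>) * real n" using assms by simp
    then show ?thesis unfolding m_def by linarith
  qed
  have m_le: "m n \<le> n" for n
  proof -
    have "(1 - \<epsilon>) * real n \<le> real_of_int (int n)" using assms by (simp add: algebra_simps)
    then have "\<lceil>(1 - \<epsilon>) * real n\<rceil> \<le> int n" by (rule ceiling_le)
    then show ?thesis unfolding m_def by linarith
  qed
  have F: "F P = random_serial_dictatorship P (m n)" if "ordinal_instance n P" for n P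
    using that by (simp add: F_def ordinal_instance_def)
  have support: "matching n M \<and> card M = m n"
    if "ordinal_instance n P" "M \<in> set_pmf (F P)" for n P M
    using that random_serial_dictatorship_matching[OF that(1) m_le] by (simp add: F)
  \<comment> \<open>The constant \<open>2 / \<epsilon>\<close> bounds
    \<open>(n + 1) / (n - m n + 1)\<close>: the numerator is at most \<open>2 * n\<close> because
    \<open>n \<ge> 1\<close>, and the denominator is at least \<open>\<epsilon> * n\<close>.\<close>
  have "measure_pmf.expectation (F P) (cost d) \<le> 2 / \<epsilon> * cost d Opt"
    if n: "1 \<le> n" and P: "ordinal_instance n P" and met: "is_metric n d" and con: "consistent n d P"
      and opt: "perfect_matching n Opt" for n P d Opt
  proof -
    let ?E = "measure_pmf.expectation (F P) (cost d)"
    have nonneg: "0 \<le> cost d Opt"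
      using cost_nonneg[OF met] opt by (simp add: perfect_matching_def)
    have E_nonneg: "0 \<le> ?E"
      by (rule Bochner_Integration.integral_nonneg_AE)
        (use support[OF P] cost_nonneg[OF met] in \<open>auto simp: AE_measure_pmf_iff\<close>)
    \<comment> \<open>The ceiling loses less than \<open>1\<close>, which the summand
      \<open>1\<close> in the potential's factor absorbs; \<open>n - m n\<close> itself may be
      \<open>0\<close>.\<close>
    have "real (m n) < (1 - \<epsilon>) * real n + 1"
      using m[of n] by linarith
    then have "\<epsilon> * real n \<le> real (n - m n + 1)"
      using m_le[of n] by (simp add: of_nat_diff algebra_simps)
    then have "\<epsilon> * real n * (?E + cost d Opt) \<le> real (n - m n + 1) * (?E + cost d Opt)"
      using nonneg E_nonneg by (intro mult_right_mono) auto
    also have "\<dots> \<le> real (n + 1) * cost d Opt"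
      using random_serial_dictatorship_potential[OF P met con opt m_le] by (simp add: F[OF P])
    also have "\<dots> \<le> 2 * real n * cost d Opt"
      using n nonneg by (intro mult_right_mono) auto
    finally have "real n * (\<epsilon> * (?E + cost d Opt)) \<le> real n * (2 * cost d Opt)"
      by (simp add: mult_ac)
    then have "\<epsilon> * (?E + cost d Opt) \<le> 2 * cost d Opt"
      using n by (simp add: mult_le_cancel_left)
    moreover have "0 \<le> \<epsilon> * cost d Opt" using assms nonneg by simp
    ultimately have "\<epsilon> * ?E \<le> 2 * cost d Opt" by (simp add: distrib_left)
    with assms show ?thesis by (simp add: field_simps)
  qed
  with support m show ?thesis
    by (intro exI[of _ "2 / \<epsilon>"] exI[of _ F])
      (simp add: randomized_mechanism_def optimal_matching_def is_arg_min_def)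
qed

end
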